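(* Let $d\ge1$. For every $N\ge2$ and every nonempty $S\subseteq\mathbb Z_N^d$, $$\operatorname{FR}(1_S)\geq\frac{N^{\frac{d}{2}}|S|}{E(S)^{\frac{1}{2}}},\qquad E(S)\geq\frac{|S|^3}{\mathcal A_N(S)^2}.$$ If $S_N\subseteq\mathbb Z_N^d$ are nonempty sets ($N$ ranging over an unbounded set of moduli) with $|S_N|=N^{\alpha+o(1)}$ and, for some $0\leq\eta\leq1$, $$E(S_N)\leq|S_N|^{3-\eta}N^{o(1)},$$ then $$\overline\kappa(\{1_{S_N}\})\leq\frac{\alpha(1-\eta)}{2}.$$
   Context: $\mathbb Z_N=\mathbb Z/N\mathbb Z$; all limits are taken within the given unbounded set of moduli. For $f:\mathbb Z_N^d\to\mathbb C$ the unitary Fourier transform is $\widehat f(\xi)=N^{-d/2}\sum_{x\in\mathbb Z_N^d}f(x)e^{-2\pi i x\cdot\xi/N}$. Norms use counting measure: $\|f\|_r=(\sum_x|f(x)|^r)^{1/r}$. $1_S$ is the indicator of $S$. For $f\neq0$, $\operatorname{FR}(f)=\|\widehat f\|_1/\|\widehat f\|_2$ and $\kappa_N(f)=\log\bigl(N^{d/2}/\operatorname{FR}(f)\bigr)/\log N$; $\overline\kappa(\{f_N\})=\limsup_{N\to\infty}\kappa_N(f_N)$. The Fourier algebra norm is $\mathcal A_N(S)=N^{-d/2}\|\widehat{1_S}\|_1$. The additive energy is $E(S)=\#\{(x_1,x_2,x_3,x_4)\in S^4:x_1+x_2=x_3+x_4\}$. $N^{o(1)}$ denotes a positive factor whose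 logarithm divided by $\log N$ tends to zero, and $|S_N|=N^{\alpha+o(1)}$ means $\log|S_N|/\log N\to\alpha$. *)

theory Defs
  imports Complex_Main "HOL-Library.FuncSet" "HOL-Library.Indicator_Function"
    "HOL-Library.Extended_Real" "HOL-Library.Liminf_Limsup"
begin

text \<open>
  The group \<open>(\<int>/N\<int>)\<^sup>d\<close> is represented by its canonical representatives: extensional
  functions on \<open>{..<d}\<close> with values in \<open>{0, \<dots>, N - 1}\<close>, added coordinatewise modulo \<open>N\<close>.
\<close>

definition ZN :: "nat \<Rightarrow> nat \<Rightarrow> (nat \<Rightarrow> int) set" where
  "ZN d N = {..<d} \<rightarrow>\<^sub>E {0..<int N}"

definition zn_add :: "nat \<Rightarrow> nat \<Rightarrow> (nat \<Rightarrow> int) \<Rightarrow> (nat \<Rightarrow> int) \<Rightarrow> (nat \<Rightarrow> int)" where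
  "zn_add d N x y = (\<lambda>i\<in>{..<d}. (x i + y i) mod int N)"

text \<open>
  The dot product is formed over the integers; it enters the Fourier transform only through
  its residue modulo \<open>N\<close>.
\<close>

definition zn_dot :: "nat \<Rightarrow> (nat \<Rightarrow> int) \<Rightarrow> (nat \<Rightarrow> int) \<Rightarrow> int" where
  "zn_dot d x \<xi> = (\<Sum>i<d. x i * \<xi> i)"

definition fourier :: "nat \<Rightarrow> nat \<Rightarrow> ((nat \<Rightarrow> int) \<Rightarrow> complex) \<Rightarrow> (nat \<Rightarrow> int) \<Rightarrow> complex" where
  "fourier d N f \<xi> = of_real (real N powr (- (real d / 2))) *
     (\<Sum>x\<in>ZN d N. f x * exp (- (2 * of_real pi * \<i> * of_int (zn_dot d x \<xi>) / of_nat N)))"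

definition zn_norm :: "nat \<Rightarrow> nat \<Rightarrow> real \<Rightarrow> ((nat \<Rightarrow> int) \<Rightarrow> complex) \<Rightarrow> real" where
  "zn_norm d N r f = (\<Sum>x\<in>ZN d N. cmod (f x) powr r) powr (1 / r)"

definition FR :: "nat \<Rightarrow> nat \<Rightarrow> ((nat \<Rightarrow> int) \<Rightarrow> complex) \<Rightarrow> real" where
  "FR d N f = zn_norm d N 1 (fourier d N f) / zn_norm d N 2 (fourier d N f)"

definition kappa :: "nat \<Rightarrow> nat \<Rightarrow> ((nat \<Rightarrow> int) \<Rightarrow> complex) \<Rightarrow> real" where
  "kappa d N f = ln (real N powr (real d / 2) / FR d N f) / ln (real N)"

text \<open>The filter for \<open>N \<rightarrow> \<infinity>\<close> within the set of moduli \<open>M\<close>.\<close>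

definition moduli :: "nat set \<Rightarrow> nat filter" where
  "moduli M = inf sequentially (principal M)"

definition kappa_bar :: "nat \<Rightarrow> nat set \<Rightarrow> (nat \<Rightarrow> (nat \<Rightarrow> int) \<Rightarrow> complex) \<Rightarrow> ereal" where
  "kappa_bar d M f = Limsup (moduli M) (\<lambda>N. ereal (kappa d N (f N)))"

definition fourier_algebra_norm :: "nat \<Rightarrow> nat \<Rightarrow> (nat \<Rightarrow> int) set \<Rightarrow> real" where
  "fourier_algebra_norm d N S =
     real N powr (- (real d / 2)) * zn_norm d N 1 (fourier d N (indicator S))"

definition additive_energy :: "nat \<Rightarrow> nat \<Rightarrow> (nat \<Rightarrow> int) set \<Rightarrow> nat" where
  "additive_energy d N S = card {(x1, x2, x3, x4). x1 \<in> S \<and> x2 \<in> S \<and> x3 \<in> S \<and> x4 \<in> S \<and>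
     zn_add d N x1 x2 = zn_add d N x3 x4}"

text \<open>\<open>subpolynomial M g\<close> says that \<open>g\<close> is a factor of the form \<open>N\<^sup>o\<^sup>(\<^sup>1\<^sup>)\<close> along \<open>M\<close>.\<close>

definition subpolynomial :: "nat set \<Rightarrow> (nat \<Rightarrow> real) \<Rightarrow> bool" where
  "subpolynomial M g \<longleftrightarrow>
     (\<forall>N\<in>M. g N > 0) \<and> ((\<lambda>N. ln (g N) / ln (real N)) \<longlongrightarrow> 0) (moduli M)"

text \<open>\<open>has_size_exponent M S \<alpha>\<close> is \<open>|S\<^sub>N| = N\<close> to the power \<open>\<alpha> + o(1)\<close> along \<open>M\<close>.\<close>

definition has_size_exponent :: "nat set \<Rightarrow> (nat \<Rightarrow> (nat \<Rightarrow> int) set) \<Rightarrow> real \<Rightarrow> bool" where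
  "has_size_exponent M S \<alpha> \<longleftrightarrow>
     ((\<lambda>N. ln (real (card (S N))) / ln (real N)) \<longlongrightarrow> \<alpha>) (moduli M)"

end

theory Submission
  imports Defs "HOL-Analysis.Analysis"
begin

text \<open>
  Orthogonality of characters gives \<open>\<Sum>|F|\<^sup>2 = |S|\<close> and \<open>\<Sum>|F|\<^sup>4 = E(S) / N\<^sup>d\<close> for the Fourier
  transform \<open>F\<close> of the indicator of \<open>S\<close>: both count pairs of equal frequencies, of \<open>x \<in> S\<close> and of
  sums \<open>x + y\<close> with \<open>x, y \<in> S\<close> respectively. Interpolating the second moment between the first
  and the fourth, \<open>(\<Sum>|F|\<^sup>2)\<^sup>3 \<le> (\<Sum>|F|)\<^sup>2 (\<Sum>|F|\<^sup>4)\<close>, yields both inequalities, and taking logarithms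
  in the first one bounds \<open>\<kappa>\<close>.
\<close>

section \<open>Characters modulo N and their orthogonality\<close>

definition zchar :: "nat \<Rightarrow> int \<Rightarrow> complex" where
  "zchar N k = cis (- (2 * pi * of_int k / real N))"

text \<open>The unnormalised transform of the indicator of \<open>S\<close>. Leaving the
  half-integral power of \<open>N\<close> out makes its second and fourth moments exactly
  \<open>N ^ d\<close> times a count.\<close>

definition exp_sum :: "nat \<Rightarrow> nat \<Rightarrow> (nat \<Rightarrow> int) set \<Rightarrow> (nat \<Rightarrow> int) \<Rightarrow> complex" where
  "exp_sum d N S \<xi> = (\<Sum>x\<in>S. zchar N (zn_dot d x \<xi>))"

lemma zchar_add: "zchar N (a + b) = zchar N a * zchar N b"
  by (simp add: zchar_def cis_mult add_divide_distrib distrib_left)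

lemma zchar_0 [simp]: "zchar N 0 = 1"
  by (simp add: zchar_def)

lemma cnj_zchar: "cnj (zchar N a) = zchar N (- a)"
  by (simp add: zchar_def cis_cnj)

lemma zchar_sum: "zchar N (\<Sum>i\<in>I. f i) = (\<Prod>i\<in>I. zchar N (f i))"
  by (induction I rule: infinite_finite_induct) (auto simp: zchar_add)

lemma zchar_power: "zchar N (k * int m) = zchar N k ^ m"
  by (induction m) (auto simp: zchar_add distrib_left)

lemma zchar_eq_1_iff:
  assumes "N > 0"
  shows "zchar N k = 1 \<longleftrightarrow> int N dvd k"
proof
  assume "zchar N k = 1"
  hence "exp (\<i> * complex_of_real (- (2 * pi * of_int k / real N))) = 1"
    by (simp add: zchar_def cis_conv_exp)
  then obtain n :: int where "- (2 * pi * of_int k / real N) = of_int (2 * n) * pi"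
    unfolding exp_eq_1 by auto
  hence "pi * real_of_int k = pi * (real N * real_of_int (- n))"
    using assms by (simp add: field_simps)
  hence "real_of_int k = real N * real_of_int (- n)"
    by (simp only: mult_cancel_left pi_neq_zero simp_thms)
  hence "real_of_int k = real_of_int (int N * (- n))"
    by simp
  hence "k = int N * (- n)"
    by (simp only: of_int_eq_iff)
  thus "int N dvd k"
    by (rule dvdI)
next
  assume "int N dvd k"
  then obtain n where n: "k = int N * n" ..
  have "- (2 * pi * of_int k / real N) = 2 * pi * real_of_int (- n)"
    using assms by (simp add: n)
  thus "zchar N k = 1"
    unfolding zchar_def by (metis cis_multiple_2pi Ints_of_int)
qed

text \<open>This is a geometric sum whose ratio \<open>zchar N k\<close> is an N-th root of unity:
  either the ratio is 1, and all terms are 1, or the numerator of the closed form vanishes.\<close>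

lemma sum_zchar:
  assumes "N > 0"
  shows "(\<Sum>m\<in>{0..<int N}. zchar N (k * m)) = (if int N dvd k then of_nat N else 0)"
proof -
  have "(\<Sum>m\<in>{0..<int N}. zchar N (k * m)) = (\<Sum>m<N. zchar N (k * int m))"
    by (rule sum.reindex_bij_witness[of _ int nat]) auto
  also have "\<dots> = (\<Sum>m<N. zchar N k ^ m)"
    by (simp add: zchar_power)
  also have "\<dots> = (if int N dvd k then of_nat N else 0)"
  proof (cases "int N dvd k")
    case True
    thus ?thesis using zchar_eq_1_iff[OF assms, of k] by simp
  next
    case False
    have "zchar N k ^ N = 1"
      using zchar_eq_1_iff[OF assms, of "k * int N"] by (simp add: zchar_power)
    thus ?thesis
      using False zchar_eq_1_iff[OF assms, of k] by (simp add: geometric_sum)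
  qed
  finally show ?thesis .
qed

lemma finite_ZN: "finite (ZN d N)"
  by (auto simp: ZN_def intro: finite_PiE)

text \<open>The character of a dot product factors over the coordinates, so the sum over the product
  set is a product of one-dimensional sums, and a single nonzero residue makes it vanish.\<close>

lemma sum_zchar_dot:
  assumes "N > 0"
  shows "(\<Sum>\<xi>\<in>ZN d N. zchar N (zn_dot d v \<xi>)) =
           (if \<forall>i<d. int N dvd v i then of_nat N ^ d else 0)"
proof -
  have "(\<Sum>\<xi>\<in>ZN d N. zchar N (zn_dot d v \<xi>)) = (\<Prod>i<d. \<Sum>m\<in>{0..<int N}. zchar N (v i * m))"
    by (simp add: prod_sum_PiE ZN_def zn_dot_def zchar_sum)
  also have "\<dots> = (\<Prod>i<d. if int N dvd v i then of_nat N else 0)"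
    by (simp add: sum_zchar assms)
  also have "\<dots> = (if \<forall>i<d. int N dvd v i then of_nat N ^ d else 0)"
    by (auto intro: prod_zero)
  finally show ?thesis .
qed

text \<open>Expanding the square gives one character sum for each pair of indices, taken at the
  difference of their frequencies. The frequencies are an indexed family of integer vectors,
  possibly repeated and not reduced modulo \<open>N\<close>, so that both \<open>x\<close> and the
  unreduced sums \<open>x + y\<close> fit.\<close>

lemma sum_norm_sq_zchar_dot:
  assumes "N > 0" "finite J"
  shows "(\<Sum>\<xi>\<in>ZN d N. (cmod (\<Sum>j\<in>J. zchar N (zn_dot d (v j) \<xi>)))\<^sup>2) =
           real N ^ d * real (card {(j, k) \<in> J \<times> J. \<forall>i<d. int N dvd v j i - v k i})"
proof -
  have dot: "zn_dot d (v j) \<xi> - zn_dot d (v k) \<xi> = zn_dot d (\<lambda>i. v j i - v k i) \<xi>" for j k \<xi>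
    by (simp add: zn_dot_def sum_subtractf left_diff_distrib)
  \<comment> \<open>The squared modulus becomes z times its conjugate in the complex numbers, where
    conjugation only negates the argument of \<open>zchar\<close>.\<close>
  have "complex_of_real (\<Sum>\<xi>\<in>ZN d N. (cmod (\<Sum>j\<in>J. zchar N (zn_dot d (v j) \<xi>)))\<^sup>2) =
      (\<Sum>\<xi>\<in>ZN d N. \<Sum>j\<in>J. \<Sum>k\<in>J. zchar N (zn_dot d (\<lambda>i. v j i - v k i) \<xi>))"
    by (simp only: of_real_sum complex_norm_square cnj_sum cnj_zchar sum_product
        zchar_add[symmetric] add_uminus_conv_diff dot)
  also have "\<dots> = (\<Sum>p\<in>J \<times> J. \<Sum>\<xi>\<in>ZN d N. zchar N (zn_dot d (\<lambda>i. v (fst p) i - v (snd p) i) \<xi>))"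
    by (subst sum.swap) (simp add: sum.cartesian_product case_prod_beta)
  also have "\<dots> = (\<Sum>p\<in>J \<times> J. if \<forall>i<d. int N dvd v (fst p) i - v (snd p) i then of_nat N ^ d else 0)"
    by (simp add: sum_zchar_dot[OF assms(1)])
  also have "\<dots> = complex_of_real
      (real N ^ d * real (card {(j, k) \<in> J \<times> J. \<forall>i<d. int N dvd v j i - v k i}))"
    using assms(2) by (simp add: sum.If_cases case_prod_unfold Int_def mem_Times_iff conj_assoc)
  finally show ?thesis
    by (simp only: of_real_eq_iff)
qed

section \<open>Second and fourth moments of the exponential sum\<close>

lemma ZN_eq_iff:
  assumes "x \<in> ZN d N" "y \<in> ZN d N"
  shows "x = y \<longleftrightarrow> (\<forall>i<d. int N dvd x i - y i)"
proof
  assume *: "\<forall>i<d. int N dvd x i - y i"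
  show "x = y"
  proof (rule PiE_ext)
    show "x \<in> {..<d} \<rightarrow>\<^sub>E {0..<int N}" "y \<in> {..<d} \<rightarrow>\<^sub>E {0..<int N}"
      using assms by (auto simp: ZN_def)
    fix i assume i: "i \<in> {..<d}"
    have "x i \<in> {0..<int N}" "y i \<in> {0..<int N}"
      using assms i unfolding ZN_def by (blast intro: PiE_mem)+
    moreover have "x i mod int N = y i mod int N"
      using * i by (simp only: mod_eq_dvd_iff lessThan_iff)
    ultimately show "x i = y i"
      by simp
  qed
qed auto

lemma zn_add_eq_iff:
  "zn_add d N x y = zn_add d N z w \<longleftrightarrow> (\<forall>i<d. int N dvd (x i + y i) - (z i + w i))"
  unfolding zn_add_def restrict_def fun_eq_iff mod_eq_dvd_iff[symmetric] lessThan_iff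
  by metis

text \<open>Canonical representatives congruent in every coordinate coincide, so only the diagonal
  of \<open>S \<times> S\<close> is counted.\<close>

lemma sum_norm_exp_sum_power2:
  assumes "N > 0" "S \<subseteq> ZN d N"
  shows "(\<Sum>\<xi>\<in>ZN d N. cmod (exp_sum d N S \<xi>) ^ 2) = real N ^ d * real (card S)"
proof -
  have fin: "finite S"
    using assms finite_ZN finite_subset by blast
  have "{(x, y) \<in> S \<times> S. \<forall>i<d. int N dvd x i - y i} = {(x, y) \<in> S \<times> S. x = y}"
    using assms(2) ZN_eq_iff by blast
  also have "\<dots> = (\<lambda>x. (x, x)) ` S"
    by auto
  finally have "card {(x, y) \<in> S \<times> S. \<forall>i<d. int N dvd x i - y i} = card S"
    by (simp add: card_image inj_on_def)
  thus ?thesis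
    using sum_norm_sq_zchar_dot[OF assms(1) fin, of d "\<lambda>x. x"] by (simp add: exp_sum_def)
qed

text \<open>The square of the exponential sum is again a sum of characters, indexed by pairs in
  \<open>S \<times> S\<close> with frequency \<open>x + y\<close>. Its second moment counts pairs of
  pairs with congruent sums, which are the additive quadruples.\<close>

lemma sum_norm_exp_sum_power4:
  assumes "N > 0" "S \<subseteq> ZN d N"
  shows "(\<Sum>\<xi>\<in>ZN d N. cmod (exp_sum d N S \<xi>) ^ 4) = real N ^ d * real (additive_energy d N S)"
proof -
  have fin: "finite (S \<times> S)"
    using assms finite_ZN finite_subset by blast
  define v where "v = (\<lambda>(p :: (nat \<Rightarrow> int) \<times> (nat \<Rightarrow> int)) i. fst p i + snd p i)"
  have sq: "exp_sum d N S \<xi> ^ 2 = (\<Sum>p\<in>S \<times> S. zchar N (zn_dot d (v p) \<xi>))" for \<xi>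
  proof -
    have "zn_dot d (v p) \<xi> = zn_dot d (fst p) \<xi> + zn_dot d (snd p) \<xi>" for p
      by (simp add: zn_dot_def v_def distrib_right sum.distrib)
    thus ?thesis
      by (simp add: exp_sum_def power2_eq_square sum_product sum.cartesian_product zchar_add
          case_prod_beta)
  qed
  have "cmod (exp_sum d N S \<xi>) ^ 4 = (cmod (\<Sum>p\<in>S \<times> S. zchar N (zn_dot d (v p) \<xi>)))\<^sup>2" for \<xi>
    by (simp flip: sq add: norm_power)
  hence "(\<Sum>\<xi>\<in>ZN d N. cmod (exp_sum d N S \<xi>) ^ 4) = real N ^ d *
      real (card {(p, q) \<in> (S \<times> S) \<times> (S \<times> S). \<forall>i<d. int N dvd v p i - v q i})"
    using sum_norm_sq_zchar_dot[OF assms(1) fin, of d v] by simp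
  also have "card {(p, q) \<in> (S \<times> S) \<times> (S \<times> S). \<forall>i<d. int N dvd v p i - v q i} =
      additive_energy d N S"
    unfolding additive_energy_def
    \<comment> \<open>Pairs of pairs are regrouped as quadruples; \<open>zn_add_eq_iff\<close> turns
      congruence of the integer sums into equality of the reduced ones.\<close>
    by (rule bij_betw_same_card[of "\<lambda>((x1, x2), (x3, x4)). (x1, x2, x3, x4)"],
        rule bij_betw_byWitness[of _ "\<lambda>(x1, x2, x3, x4). ((x1, x2), (x3, x4))"])
      (auto simp: zn_add_eq_iff v_def)
  finally show ?thesis .
qed

section \<open>Interpolation of moments\<close>

lemma sum_power2_cubed_le:
  fixes a :: "'a \<Rightarrow> real"
  assumes "\<And>i. i \<in> I \<Longrightarrow> a i \<ge> 0"
  shows "(\<Sum>i\<in>I. a i ^ 2) ^ 3 \<le> (\<Sum>i\<in>I. a i)\<^sup>2 * (\<Sum>i\<in>I. a i ^ 4)"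
\<comment> \<open>The main case ends by cancelling the second moment, so its vanishing is treated
  first.\<close>
proof (cases "(\<Sum>i\<in>I. a i ^ 2) = 0")
  case True
  thus ?thesis by (simp add: sum_nonneg)
next
  case False
  define A1 A2 A3 A4 where "A1 = (\<Sum>i\<in>I. a i)" and "A2 = (\<Sum>i\<in>I. a i ^ 2)"
    and "A3 = (\<Sum>i\<in>I. a i ^ 3)" and "A4 = (\<Sum>i\<in>I. a i ^ 4)"
  have nonneg: "A1 \<ge> 0" "A2 \<ge> 0"
    using assms by (auto simp: A1_def A2_def intro: sum_nonneg)
  with False have "A2 > 0"
    by (simp add: A2_def)
  \<comment> \<open>Cauchy-Schwarz for the exponent splitting 2 = 1/2 + 3/2 brings in the third
    moment.\<close>
  have "(\<Sum>i\<in>I. sqrt (a i) * (a i * sqrt (a i)))\<^sup>2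
      \<le> (\<Sum>i\<in>I. (sqrt (a i))\<^sup>2) * (\<Sum>i\<in>I. (a i * sqrt (a i))\<^sup>2)"
    by (rule Cauchy_Schwarz_ineq_sum)
  also have "(\<Sum>i\<in>I. sqrt (a i) * (a i * sqrt (a i))) = A2"
    unfolding A2_def by (rule sum.cong) (auto simp: assms power2_eq_square)
  also have "(\<Sum>i\<in>I. (sqrt (a i))\<^sup>2) = A1"
    unfolding A1_def by (rule sum.cong) (auto simp: assms)
  also have "(\<Sum>i\<in>I. (a i * sqrt (a i))\<^sup>2) = A3"
    unfolding A3_def by (rule sum.cong) (auto simp: assms power_mult_distrib eval_nat_numeral)
  finally have "A2\<^sup>2 \<le> A1 * A3" .
  hence "(A2\<^sup>2)\<^sup>2 \<le> (A1 * A3)\<^sup>2"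
    by (rule power_mono) simp
  \<comment> \<open>A second Cauchy-Schwarz, for 3 = 1 + 2, eliminates the third moment at the cost
    of one factor \<open>A2\<close>.\<close>
  also have "A3\<^sup>2 \<le> A2 * A4"
    using Cauchy_Schwarz_ineq_sum[of a "\<lambda>i. (a i)\<^sup>2" I]
    by (simp add: A2_def A3_def A4_def power2_eq_square power3_eq_cube power4_eq_xxxx mult.assoc)
  hence "(A1 * A3)\<^sup>2 \<le> A1\<^sup>2 * (A2 * A4)"
    by (simp add: power_mult_distrib mult_left_mono)
  finally have "A2 * A2 ^ 3 \<le> A2 * (A1\<^sup>2 * A4)"
    by (simp add: eval_nat_numeral mult_ac)
  with \<open>A2 > 0\<close> have "A2 ^ 3 \<le> A1\<^sup>2 * A4"
    by simp
  thus ?thesis by (simp add: A1_def A2_def A4_def)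
qed

section \<open>Fourier norms in terms of the exponential sum\<close>

lemma powr_half_power2:
  assumes "N > 0"
  shows "(real N powr (real d / 2))\<^sup>2 = real N ^ d"
  using assms
  by (simp only: power2_eq_square powr_add[symmetric] field_sum_of_halves powr_realpow of_nat_0_less_iff)

lemma fourier_indicator:
  assumes "S \<subseteq> ZN d N"
  shows "fourier d N (indicator S) \<xi> = of_real (real N powr (- (real d / 2))) * exp_sum d N S \<xi>"
proof -
  have "exp (- (2 * of_real pi * \<i> * of_int k / of_nat N)) = zchar N k" for k
    by (simp add: zchar_def cis_conv_exp mult_ac)
  moreover have "(\<Sum>x\<in>ZN d N. indicator S x * zchar N (zn_dot d x \<xi>)) = exp_sum d N S \<xi>"
    unfolding exp_sum_def
    by (rule sum.mono_neutral_cong_right) (use assms finite_ZN in \<open>auto simp: indicator_def\<close>)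
  ultimately show ?thesis
    by (simp add: fourier_def)
qed

lemma zn_norm_1_fourier_indicator:
  assumes "S \<subseteq> ZN d N"
  shows "zn_norm d N 1 (fourier d N (indicator S)) =
           real N powr (- (real d / 2)) * (\<Sum>\<xi>\<in>ZN d N. cmod (exp_sum d N S \<xi>))"
  using assms by (simp add: zn_norm_def fourier_indicator norm_mult sum_distrib_left sum_nonneg)

text \<open>Parseval for an indicator: the squared normalisation cancels the factor
  \<open>N ^ d\<close> of the second moment.\<close>

lemma zn_norm_2_fourier_indicator:
  assumes "N > 0" "S \<subseteq> ZN d N"
  shows "zn_norm d N 2 (fourier d N (indicator S)) = sqrt (real (card S))"
proof -
  have "(\<Sum>\<xi>\<in>ZN d N. cmod (fourier d N (indicator S) \<xi>) powr 2) =
      (real N powr (- (real d / 2)))\<^sup>2 * (\<Sum>\<xi>\<in>ZN d N. cmod (exp_sum d N S \<xi>) ^ 2)"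
    using assms by (simp add: fourier_indicator norm_mult power_mult_distrib sum_distrib_left)
  also have "(real N powr (- (real d / 2)))\<^sup>2 = inverse (real N ^ d)"
    using assms(1) by (simp add: powr_minus power_inverse powr_half_power2)
  finally show ?thesis
    using assms by (simp add: zn_norm_def sum_norm_exp_sum_power2 powr_half_sqrt)
qed

section \<open>The two inequalities for a fixed modulus\<close>

lemma exp_sum_energy_bound:
  assumes "N > 0" "S \<subseteq> ZN d N"
  shows "(real N ^ d)\<^sup>2 * real (card S) ^ 3 \<le>
           (\<Sum>\<xi>\<in>ZN d N. cmod (exp_sum d N S \<xi>))\<^sup>2 * real (additive_energy d N S)"
proof -
  define L where "L = (\<Sum>\<xi>\<in>ZN d N. cmod (exp_sum d N S \<xi>))"
  have "(real N ^ d * real (card S)) ^ 3 \<le> L\<^sup>2 * (real N ^ d * real (additive_energy d N S))"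
    using sum_power2_cubed_le[of "ZN d N" "\<lambda>\<xi>. cmod (exp_sum d N S \<xi>)"] assms
    by (simp add: sum_norm_exp_sum_power2 sum_norm_exp_sum_power4 L_def)
  \<comment> \<open>The moments contribute three factors \<open>N ^ d\<close> on the left and one on
    the right; the common one is split off for cancellation.\<close>
  hence "real N ^ d * ((real N ^ d)\<^sup>2 * real (card S) ^ 3) \<le>
      real N ^ d * (L\<^sup>2 * real (additive_energy d N S))"
    by (simp add: power2_eq_square power3_eq_cube mult_ac)
  thus ?thesis
    using assms(1) by (simp add: L_def)
qed

text \<open>Each \<open>x\<close> in \<open>S\<close> gives the solution
  \<open>(x, x, x, x)\<close>. Positivity permits dividing by the square root of the energy and
  taking its logarithm.\<close>

lemma additive_energy_pos:
  assumes "finite S" "S \<noteq> {}"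
  shows "additive_energy d N S > 0"
proof -
  have "finite {(x1, x2, x3, x4). x1 \<in> S \<and> x2 \<in> S \<and> x3 \<in> S \<and> x4 \<in> S \<and>
      zn_add d N x1 x2 = zn_add d N x3 x4}"
    by (rule finite_subset[of _ "S \<times> S \<times> S \<times> S"]) (use assms in auto)
  thus ?thesis
    using assms(2) by (auto simp: additive_energy_def card_gt_0_iff)
qed

lemma FR_indicator_ge:
  assumes "N > 0" "S \<subseteq> ZN d N" "S \<noteq> {}"
  shows "FR d N (indicator S) \<ge>
           real N powr (real d / 2) * real (card S) / sqrt (real (additive_energy d N S))"
proof -
  define L c E where "L = (\<Sum>\<xi>\<in>ZN d N. cmod (exp_sum d N S \<xi>))" and "c = real (card S)"
    and "E = real (additive_energy d N S)"
  define q where "q = real N powr (real d / 2)"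
  have fin: "finite S"
    using assms finite_ZN finite_subset by blast
  have pos: "c > 0" "E > 0" "q > 0" "L \<ge> 0"
    using assms fin additive_energy_pos
    by (auto simp: c_def E_def q_def L_def card_gt_0_iff intro: sum_nonneg)
  have q2: "q\<^sup>2 = real N ^ d"
    using assms(1) by (simp add: q_def powr_half_power2)
  have "(q\<^sup>2 * (c * sqrt c))\<^sup>2 = (real N ^ d)\<^sup>2 * c ^ 3"
    using pos by (simp add: q2 power_mult_distrib power3_eq_cube power2_eq_square[of c])
  also have "\<dots> \<le> L\<^sup>2 * E"
    using exp_sum_energy_bound[OF assms(1,2)] by (simp add: L_def c_def E_def)
  also have "\<dots> = (L * sqrt E)\<^sup>2"
    using pos by (simp add: power_mult_distrib)
  finally have "q\<^sup>2 * (c * sqrt c) \<le> L * sqrt E"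
    by (rule power2_le_imp_le) (use pos in simp)
  \<comment> \<open>Division by \<open>q * sqrt c * sqrt E\<close> leaves on the right the quotient
    of the two norms, \<open>L / q\<close> and \<open>sqrt c\<close>.\<close>
  hence "q * c / sqrt E \<le> inverse q * L / sqrt c"
    using pos by (simp add: field_simps power2_eq_square)
  also have "\<dots> = FR d N (indicator S)"
    using assms by (simp add: FR_def zn_norm_1_fourier_indicator zn_norm_2_fourier_indicator
        powr_minus q_def L_def c_def)
  finally show ?thesis
    by (simp add: q_def c_def E_def)
qed

lemma additive_energy_ge:
  assumes "N > 0" "S \<subseteq> ZN d N" "S \<noteq> {}"
  shows "real (additive_energy d N S) \<ge> real (card S) ^ 3 / (fourier_algebra_norm d N S)\<^sup>2"
proof -
  define L c E where "L = (\<Sum>\<xi>\<in>ZN d N. cmod (exp_sum d N S \<xi>))" and "c = real (card S)"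
    and "E = real (additive_energy d N S)"
  define Q where "Q = real N ^ d"
  have fin: "finite S"
    using assms finite_ZN finite_subset by blast
  have pos: "c > 0" "Q > 0"
    using assms fin by (auto simp: c_def Q_def card_gt_0_iff)
  \<comment> \<open>One half power comes from the unitary transform, the other from the algebra
    norm.\<close>
  have "real N powr - (real d / 2) * real N powr - (real d / 2) = inverse Q"
    using powr_half_power2[OF assms(1), of d]
    by (simp add: Q_def powr_minus power2_eq_square flip: inverse_mult_distrib)
  hence A: "fourier_algebra_norm d N S = inverse Q * L"
    using assms(2) by (simp add: fourier_algebra_norm_def zn_norm_1_fourier_indicator L_def
        flip: mult.assoc)
  have bound: "Q\<^sup>2 * c ^ 3 \<le> L\<^sup>2 * E"
    using exp_sum_energy_bound[OF assms(1,2)] by (simp add: Q_def L_def c_def E_def)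
  \<comment> \<open>A positive lower bound forces \<open>L\<close> to be nonzero, so the inequality
    may be divided by its square.\<close>
  moreover have "Q\<^sup>2 * c ^ 3 > 0"
    using pos by simp
  ultimately have "L \<noteq> 0"
    by auto
  with bound have "c ^ 3 / (inverse Q * L)\<^sup>2 \<le> E"
    using pos by (simp add: field_simps power_mult_distrib)
  thus ?thesis
    by (simp add: A c_def E_def)
qed

section \<open>Logarithmic exponents and the limit along the moduli\<close>

lemma moduli_neq_bot:
  assumes "infinite M"
  shows "moduli M \<noteq> bot"
proof -
  have "\<exists>N\<in>M. N \<ge> n" for n
    using assms unfolding infinite_nat_iff_unbounded_le by blast
  thus ?thesis
    by (auto simp: moduli_def trivial_limit_def eventually_inf_principal eventually_sequentially)
qed

text \<open>The non-asymptotic form, with \<open>h\<close> the value of the subpolynomial factor at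
  one modulus. The bound on \<open>FR\<close> cancels the power of \<open>N\<close> inside the
  logarithm and leaves \<open>sqrt E / c\<close>; inserting the energy hypothesis gives the
  coefficient (3 - \<eta>)/2 - 1 = (1 - \<eta>)/2 of \<open>ln c\<close>.\<close>

lemma kappa_indicator_le:
  assumes "N \<ge> 2" "S \<subseteq> ZN d N" "S \<noteq> {}" "h > 0"
    and energy: "real (additive_energy d N S) \<le> real (card S) powr (3 - \<eta>) * h"
  shows "kappa d N (indicator S) \<le>
           (1 - \<eta>) / 2 * (ln (real (card S)) / ln (real N)) + 1 / 2 * (ln h / ln (real N))"
proof -
  define c E where "c = real (card S)" and "E = real (additive_energy d N S)"
  define q F where "q = real N powr (real d / 2)" and "F = FR d N (indicator S)"
  have fin: "finite S"
    using assms finite_ZN finite_subset by blast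
  have pos: "c > 0" "E > 0" "q > 0"
    using assms fin additive_energy_pos
    by (auto simp: c_def E_def q_def card_gt_0_iff)
  have F: "q * c / sqrt E \<le> F"
    using FR_indicator_ge[of N S d] assms by (simp add: q_def c_def E_def F_def)
  moreover have "q * c / sqrt E > 0"
    using pos by simp
  ultimately have "F > 0"
    by linarith
  have "q / F \<le> sqrt E / c"
    using F \<open>F > 0\<close> pos by (simp add: field_simps)
  hence "ln (q / F) \<le> ln (sqrt E / c)"
    using \<open>F > 0\<close> pos by (subst ln_le_cancel_iff) auto
  also have "\<dots> = ln E / 2 - ln c"
    using pos by (simp add: ln_div ln_sqrt)
  also have "ln E \<le> ln (c powr (3 - \<eta>) * h)"
    using energy pos assms(4) by (subst ln_le_cancel_iff) (auto simp: c_def E_def)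
  hence "ln E / 2 - ln c \<le> (1 - \<eta>) / 2 * ln c + 1 / 2 * ln h"
    using pos assms(4) by (simp add: ln_mult ln_powr field_simps)
  finally have "ln (q / F) / ln (real N) \<le> ((1 - \<eta>) / 2 * ln c + 1 / 2 * ln h) / ln (real N)"
    using assms(1) by (intro divide_right_mono) auto
  thus ?thesis
    by (simp add: kappa_def q_def F_def c_def add_divide_distrib)
qed

lemma kappa_bar_indicator_le:
  assumes "infinite M" "\<forall>N\<in>M. N \<ge> 2" "\<forall>N\<in>M. S N \<subseteq> ZN d N \<and> S N \<noteq> {}"
    and size: "has_size_exponent M S \<alpha>" and g: "subpolynomial M g"
    and energy: "\<forall>N\<in>M. real (additive_energy d N (S N)) \<le> real (card (S N)) powr (3 - \<eta>) * g N"
  shows "kappa_bar d M (\<lambda>N. indicator (S N)) \<le> ereal (\<alpha> * (1 - \<eta>) / 2)"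
proof -
  \<comment> \<open>The majorant is linear in two logarithmic ratios with limits \<alpha> and 0, so
    it converges and monotonicity of \<open>Limsup\<close> suffices.\<close>
  define u where "u = (\<lambda>N. (1 - \<eta>) / 2 * (ln (real (card (S N))) / ln (real N)) +
    1 / 2 * (ln (g N) / ln (real N)))"
  have "(u \<longlongrightarrow> (1 - \<eta>) / 2 * \<alpha> + 1 / 2 * 0) (moduli M)"
    unfolding u_def using size g
    by (intro tendsto_intros) (auto simp: has_size_exponent_def subpolynomial_def)
  hence "((\<lambda>N. ereal (u N)) \<longlongrightarrow> ereal (\<alpha> * (1 - \<eta>) / 2)) (moduli M)"
    by (simp add: mult.commute)
  \<comment> \<open>Identifying the upper limit with the limit requires a nontrivial filter; this is
    where the infinitude of \<open>M\<close> enters.\<close>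
  hence "Limsup (moduli M) (\<lambda>N. ereal (u N)) = ereal (\<alpha> * (1 - \<eta>) / 2)"
    by (rule lim_imp_Limsup[OF moduli_neq_bot[OF assms(1)]])
  moreover have "kappa d N (indicator (S N)) \<le> u N" if "N \<in> M" for N
    unfolding u_def using that assms(2,3) g energy
    by (intro kappa_indicator_le) (auto simp: subpolynomial_def)
  hence "\<forall>\<^sub>F N in moduli M. ereal (kappa d N (indicator (S N))) \<le> ereal (u N)"
    by (auto simp: moduli_def eventually_inf_principal)
  hence "kappa_bar d M (\<lambda>N. indicator (S N)) \<le> Limsup (moduli M) (\<lambda>N. ereal (u N))"
    unfolding kappa_bar_def by (rule Limsup_mono)
  ultimately show ?thesis
    by simp
qed

theorem proposition8p3:
  fixes d :: nat
  assumes "d \<ge> 1"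
  shows "(\<forall>N S. N \<ge> 2 \<longrightarrow> S \<subseteq> ZN d N \<longrightarrow> S \<noteq> {} \<longrightarrow>
            FR d N (indicator S) \<ge>
              real N powr (real d / 2) * real (card S) / sqrt (real (additive_energy d N S)) \<and>
            real (additive_energy d N S) \<ge> real (card S) ^ 3 / (fourier_algebra_norm d N S)\<^sup>2) \<and>
         (\<forall>(M :: nat set) (S :: nat \<Rightarrow> (nat \<Rightarrow> int) set) (\<alpha> :: real) (\<eta> :: real).
            infinite M \<longrightarrow>
            (\<forall>N\<in>M. N \<ge> 2) \<longrightarrow>
            (\<forall>N\<in>M. S N \<subseteq> ZN d N \<and> S N \<noteq> {}) \<longrightarrow>
            has_size_exponent M S \<alpha> \<longrightarrow>
            0 \<le> \<eta> \<longrightarrow> \<eta> \<le> 1 \<longrightarrow>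
            (\<exists>g. subpolynomial M g \<and>
               (\<forall>N\<in>M. real (additive_energy d N (S N)) \<le> real (card (S N)) powr (3 - \<eta>) * g N)) \<longrightarrow>
            kappa_bar d M (\<lambda>N. indicator (S N)) \<le> ereal (\<alpha> * (1 - \<eta>) / 2))"
proof (intro conjI allI impI)
  fix N :: nat and S :: "(nat \<Rightarrow> int) set"
  assume *: "N \<ge> 2" "S \<subseteq> ZN d N" "S \<noteq> {}"
  hence "N > 0" by simp
  show "FR d N (indicator S) \<ge>
      real N powr (real d / 2) * real (card S) / sqrt (real (additive_energy d N S))"
    by (rule FR_indicator_ge) fact+
  show "real (additive_energy d N S) \<ge> real (card S) ^ 3 / (fourier_algebra_norm d N S)\<^sup>2"
    by (rule additive_energy_ge) fact+
qed (elim exE conjE, rule kappa_bar_indicator_le)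

end
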